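(* Let $G$ be a graph (loops and multiple edges allowed) and let $\mathcal W$ be a set of closed walks in $G$. Then there exists a signature $\sigma: E(G)\to\{+,-\}$ such that $\mathcal W$ is exactly the set of negative closed walks of the signed graph $(G,\sigma)$ if and only if $\mathcal W$ is closed under rotation and satisfies the exclusive 3-walk property.
   Context: A signed graph $(G,\sigma)$ is a graph $G$ together with a signature $\sigma:E(G)\to\{+,-\}$. A closed walk in $(G,\sigma)$ is negative if it traverses an odd number of edges marked $-$ (counted with multiplicity). A rotation of a closed walk $W$ is a closed walk with the same cyclic sequence of edges as $W$ but starting at a different vertex of $W$; a set of closed walks is closed under rotation if it contains every rotation of each of its members. For walks $W_1$ (from $x$ to $y$) and $W_2$ (from $x$ to $y$), $W_2^{-1}$ denotes the reverse walk and $W_1W_2^{-1}$ the concatenation, a closed walk at $x$; trivial walks (a single vertex, no edges) are closed walks. For a set $\mathcal W$ of closed walks define $\sigma_{\mathcal W}(W)=-$ if $W\in\mathcal W$ and $\sigma_{\mathcal W}(W)=+$ otherwise. $\mathcal W$ satisfies the exclusive 3-walk property if for every two vertices $x,y$ and every three $xy$-walks $W_1,W_2,W_3$ we have $\sigma_{\mathcal W}(W_1W_2^{-1})\cdot\sigma_{\mathcal W}(W_1W_3^{-1})\cdot\sigma_{\mathcal W}(W_2W_3^{-1})=+$, i.e. an even number of these three closed walks lie in $\mathcal W$. *)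

theory Defs
  imports Main "HOL-Library.Uprod" "HOL-Library.FuncSet"
begin

text \<open>
  Undirected graphs, finite or infinite: distinct edges may have the same unordered pair of
  end-vertices (multiple edges), and an edge with ends \<^term>\<open>Upair v v\<close> is a loop at \<^term>\<open>v\<close>.
\<close>

record ('v, 'e) mgraph =
  verts :: "'v set"
  edges :: "'e set"
  ends :: "'e \<Rightarrow> 'v uprod"

definition is_graph :: "('v, 'e) mgraph \<Rightarrow> bool" where
  "is_graph G \<longleftrightarrow> (\<forall>e\<in>edges G. set_uprod (ends G e) \<subseteq> verts G)"

text \<open>
  The walk \<open>v\<^sub>0 e\<^sub>1 v\<^sub>1 \<dots> e\<^sub>n v\<^sub>n\<close> is represented by the vertex list \<open>[v\<^sub>0, \<dots>, v\<^sub>n]\<close> paired with the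
  edge list \<open>[e\<^sub>1, \<dots>, e\<^sub>n]\<close>; the trivial walk at \<open>v\<close> is \<open>([v], [])\<close>.
\<close>

type_synonym ('v, 'e) walk = "'v list \<times> 'e list"

definition walk_betw :: "('v, 'e) mgraph \<Rightarrow> 'v \<Rightarrow> ('v, 'e) walk \<Rightarrow> 'v \<Rightarrow> bool" where
  "walk_betw G x W y \<longleftrightarrow>
     (case W of (vs, es) \<Rightarrow>
        length vs = Suc (length es) \<and> hd vs = x \<and> last vs = y \<and>
        set vs \<subseteq> verts G \<and> set es \<subseteq> edges G \<and>
        (\<forall>i<length es. ends G (es ! i) = Upair (vs ! i) (vs ! Suc i)))"

definition closed_walks :: "('v, 'e) mgraph \<Rightarrow> ('v, 'e) walk set" where
  "closed_walks G = {W. \<exists>x. walk_betw G x W x}"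

definition walk_rev :: "('v, 'e) walk \<Rightarrow> ('v, 'e) walk" where
  "walk_rev W = (rev (fst W), rev (snd W))"

text \<open>Meaningful only if the last vertex of the first walk is the first vertex of the second.\<close>

definition walk_append :: "('v, 'e) walk \<Rightarrow> ('v, 'e) walk \<Rightarrow> ('v, 'e) walk" where
  "walk_append W W' = (fst W @ tl (fst W'), snd W @ snd W')"

text \<open>
  Starting a closed walk at its vertex \<open>y\<close> instead of \<open>x\<close> means splitting it at an occurrence of
  \<open>y\<close> and swapping the two parts.
\<close>

definition is_rotation :: "('v, 'e) mgraph \<Rightarrow> ('v, 'e) walk \<Rightarrow> ('v, 'e) walk \<Rightarrow> bool" where
  "is_rotation G W W' \<longleftrightarrow>
     (\<exists>x y P Q. walk_betw G x P y \<and> walk_betw G y Q x \<and>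
        W = walk_append P Q \<and> W' = walk_append Q P)"

definition closed_under_rotation :: "('v, 'e) mgraph \<Rightarrow> ('v, 'e) walk set \<Rightarrow> bool" where
  "closed_under_rotation G \<W> \<longleftrightarrow> (\<forall>W\<in>\<W>. \<forall>W'. is_rotation G W W' \<longrightarrow> W' \<in> \<W>)"

text \<open>The signs \<open>+\<close> and \<open>-\<close> are the integers \<open>1\<close> and \<open>-1\<close>.\<close>

definition signatures :: "('v, 'e) mgraph \<Rightarrow> ('e \<Rightarrow> int) set" where
  "signatures G = edges G \<rightarrow>\<^sub>E {1, - 1}"

definition negative_closed_walks :: "('v, 'e) mgraph \<Rightarrow> ('e \<Rightarrow> int) \<Rightarrow> ('v, 'e) walk set" where
  "negative_closed_walks G \<sigma> =
     {W \<in> closed_walks G. odd (length (filter (\<lambda>e. \<sigma> e = - 1) (snd W)))}"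

definition set_sign :: "('v, 'e) walk set \<Rightarrow> ('v, 'e) walk \<Rightarrow> int" where
  "set_sign \<W> W = (if W \<in> \<W> then - 1 else 1)"

definition exclusive_3_walk_property :: "('v, 'e) mgraph \<Rightarrow> ('v, 'e) walk set \<Rightarrow> bool" where
  "exclusive_3_walk_property G \<W> \<longleftrightarrow>
     (\<forall>x\<in>verts G. \<forall>y\<in>verts G. \<forall>W\<^sub>1 W\<^sub>2 W\<^sub>3.
        walk_betw G x W\<^sub>1 y \<and> walk_betw G x W\<^sub>2 y \<and> walk_betw G x W\<^sub>3 y \<longrightarrow>
        set_sign \<W> (walk_append W\<^sub>1 (walk_rev W\<^sub>2)) *
        set_sign \<W> (walk_append W\<^sub>1 (walk_rev W\<^sub>3)) *
        set_sign \<W> (walk_append W\<^sub>2 (walk_rev W\<^sub>3)) = 1)"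

end

theory Submission imports Defs begin

text \<open>
  Write \<open>s\<close> for the sign function of \<open>\<W>\<close>. For the nontrivial direction, choose a root in every
  component and a walk \<open>p v\<close> from the root of the component of \<open>v\<close> to \<open>v\<close>, and give an edge \<open>e\<close>
  with ends \<open>u\<close>, \<open>v\<close> the sign \<open>s (p u \<cdot> e \<cdot> (p v)\<^sup>-\<^sup>1)\<close>. The exclusive 3-walk property is the
  cocycle rule \<open>s (A B\<^sup>-\<^sup>1) s (B C\<^sup>-\<^sup>1) = s (A C\<^sup>-\<^sup>1)\<close>. It makes the sign of an edge independent of its
  orientation and shows, by induction along a walk \<open>V\<close> from \<open>x\<close> to \<open>y\<close>, that the product of the
  edge signs of \<open>V\<close> is \<open>s (p x \<cdot> V \<cdot> (p y)\<^sup>-\<^sup>1)\<close>. If \<open>V\<close> is closed, a rotation turns this walk into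
  \<open>V \<cdot> (p x)\<^sup>-\<^sup>1 \<cdot> p x\<close>, whose sign is \<open>s V\<close> by the cocycle rule again.
\<close>

section \<open>Calculus of walks: induction, concatenation, reversal\<close>

lemma walk_betw_Cons:
  "walk_betw G x (u # vs, e # es) y \<longleftrightarrow>
     u = x \<and> x \<in> verts G \<and> e \<in> edges G \<and> ends G e = Upair x (hd vs) \<and> walk_betw G (hd vs) (vs, es) y"
  by (cases vs) (auto simp: walk_betw_def All_less_Suc2)

lemma walk_betw_Nil: "walk_betw G x (vs, []) y \<longleftrightarrow> vs = [x] \<and> x = y \<and> x \<in> verts G"
  by (auto simp: walk_betw_def length_Suc_conv)

text \<open>Peeling off the first edge shortens the vertex list and the edge list together. The fact
  \<open>vs \<noteq> []\<close> is passed on so that \<open>hd vs\<close> is meaningful in the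
  step.\<close>

lemma walk_betw_induct [consumes 1, case_names trivial step]:
  assumes "walk_betw G x (vs, es) y"
    and "\<And>x. x \<in> verts G \<Longrightarrow> P x [x] [] x"
    and "\<And>x v vs e es y. \<lbrakk>x \<in> verts G; e \<in> edges G; ends G e = Upair x v; hd vs = v; vs \<noteq> [];
           walk_betw G v (vs, es) y; P v vs es y\<rbrakk> \<Longrightarrow> P x (x # vs) (e # es) y"
  shows "P x vs es y"
  using assms(1)
proof (induction es arbitrary: x vs)
  case Nil
  then show ?case by (auto simp: walk_betw_Nil intro: assms(2))
next
  case (Cons e es)
  then obtain u us where vs: "vs = u # us" and "us \<noteq> []"
    by (cases vs; cases "tl vs") (auto simp: walk_betw_def)
  with Cons.prems have *: "u = x" "x \<in> verts G" "e \<in> edges G" "ends G e = Upair x (hd us)"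
      "walk_betw G (hd us) (us, es) y"
    by (simp_all add: walk_betw_Cons)
  show ?case
    unfolding vs \<open>u = x\<close> by (rule assms(3)) (use * \<open>us \<noteq> []\<close> Cons.IH in auto)
qed

lemma walk_betwD:
  assumes "walk_betw G x W y"
  shows "fst W \<noteq> []" "hd (fst W) = x" "last (fst W) = y" "x \<in> verts G" "y \<in> verts G"
proof -
  from assms show 1: "fst W \<noteq> []" "hd (fst W) = x" "last (fst W) = y"
    by (auto simp: walk_betw_def)
  have "set (fst W) \<subseteq> verts G" using assms by (auto simp: walk_betw_def)
  with 1 show "x \<in> verts G" "y \<in> verts G" by (metis hd_in_set subsetD, metis last_in_set subsetD)
qed

lemma walk_betw_append:
  assumes "walk_betw G x P y" and Q: "walk_betw G y Q z"
  shows "walk_betw G x (walk_append P Q) z"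
proof -
  obtain vs es where P: "P = (vs, es)" by (cases P)
  from assms(1) have "walk_betw G x (vs, es) y" unfolding P .
  then show ?thesis using Q unfolding P
  proof (induction rule: walk_betw_induct)
    case (trivial x)
    then have "[x] @ tl (fst Q) = fst Q" using walk_betwD(1,2)[OF trivial(2)] by (cases "fst Q") auto
    with trivial show ?case by (simp add: walk_append_def)
  next
    case (step x v vs e es y)
    then show ?case by (simp add: walk_append_def walk_betw_Cons)
  qed
qed

lemma walk_betw_edge:
  "\<lbrakk>x \<in> verts G; y \<in> verts G; e \<in> edges G; ends G e = Upair x y\<rbrakk> \<Longrightarrow> walk_betw G x ([x, y], [e]) y"
  by (simp add: walk_betw_Cons walk_betw_Nil)

lemma walk_betw_trivial: "x \<in> verts G \<Longrightarrow> walk_betw G x ([x], []) x"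
  by (simp add: walk_betw_Nil)

lemma walk_betw_rev:
  assumes "walk_betw G x P y"
  shows "walk_betw G y (walk_rev P) x"
proof -
  obtain vs es where P: "P = (vs, es)" by (cases P)
  from assms(1) have "walk_betw G x (vs, es) y" unfolding P .
  then show ?thesis unfolding P
  proof (induction rule: walk_betw_induct)
    case (trivial x)
    then show ?case by (simp add: walk_rev_def walk_betw_Nil)
  next
    case (step x v vs e es y)
    then have "walk_betw G v ([v, x], [e]) x"
      by (intro walk_betw_edge) (auto dest: walk_betwD)
    from walk_betw_append[OF step.IH this] show ?case
      by (simp add: walk_rev_def walk_append_def)
  qed
qed

lemma walk_rev_rev [simp]: "walk_rev (walk_rev W) = W"
  by (simp add: walk_rev_def)

text \<open>Concatenation drops the shared vertex from the second walk. After reversal the other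
  copy is dropped, so the two copies must coincide, which the hypotheses ensure.\<close>

lemma walk_rev_append:
  assumes "walk_betw G x P y" and "walk_betw G y Q z"
  shows "walk_rev (walk_append P Q) = walk_append (walk_rev Q) (walk_rev P)"
proof -
  obtain ps where "fst P = ps @ [y]"
    using walk_betwD(1,3)[OF assms(1)] by (metis append_butlast_last_id)
  moreover obtain qs where "fst Q = y # qs"
    using walk_betwD(1,2)[OF assms(2)] by (metis list.collapse)
  ultimately show ?thesis by (simp add: walk_rev_def walk_append_def)
qed

lemma walk_append_assoc:
  "fst Q \<noteq> [] \<Longrightarrow> walk_append (walk_append P Q) R = walk_append P (walk_append Q R)"
  by (simp add: walk_append_def)

lemma walk_append_trivial_right [simp]: "walk_append P ([x], []) = P"
  by (simp add: walk_append_def)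

lemma walk_append_trivial_left: "walk_betw G x P y \<Longrightarrow> walk_append ([x], []) P = P"
  using walk_betwD(1,2)[of G x P y] by (cases P; cases "fst P") (auto simp: walk_append_def)

lemma set_sign_range: "set_sign \<W> W \<in> {1, - 1}"
  by (simp add: set_sign_def)

section \<open>Necessity: properties of negative closed walks\<close>

lemma negative_closed_walks_rotation: "closed_under_rotation G (negative_closed_walks G \<sigma>)"
  unfolding closed_under_rotation_def
proof (intro ballI allI impI)
  fix W W'
  assume W: "W \<in> negative_closed_walks G \<sigma>" and "is_rotation G W W'"
  then obtain x y P Q where PQ: "walk_betw G x P y" "walk_betw G y Q x"
      "W = walk_append P Q" "W' = walk_append Q P"
    by (auto simp: is_rotation_def)
  then have "W' \<in> closed_walks G"
    by (auto simp: closed_walks_def intro: walk_betw_append)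
  with W PQ show "W' \<in> negative_closed_walks G \<sigma>"
    by (simp add: negative_closed_walks_def walk_append_def)
qed

lemma set_sign_negative_closed_walks:
  assumes "walk_betw G x V y" and "walk_betw G x W y"
  shows "set_sign (negative_closed_walks G \<sigma>) (walk_append V (walk_rev W)) =
    (- 1) ^ (length (filter (\<lambda>e. \<sigma> e = - 1) (snd V)) + length (filter (\<lambda>e. \<sigma> e = - 1) (snd W)))"
proof -
  have "walk_append V (walk_rev W) \<in> closed_walks G"
    using assms by (auto simp: closed_walks_def intro: walk_betw_append walk_betw_rev)
  then show ?thesis
    by (simp add: set_sign_def negative_closed_walks_def walk_append_def walk_rev_def
        rev_filter[symmetric] minus_one_power_iff)
qed

text \<open>Each of the three walks enters two of the three closed walks, so the total number of
  negative edges is even.\<close>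

lemma negative_closed_walks_exclusive: "exclusive_3_walk_property G (negative_closed_walks G \<sigma>)"
  unfolding exclusive_3_walk_property_def
  by (auto simp: set_sign_negative_closed_walks minus_one_power_iff)

section \<open>Sufficiency: roots, the cocycle rule and the signature\<close>

lemma connecting_walks:
  obtains r p where "\<And>v. v \<in> verts G \<Longrightarrow> walk_betw G (r v) (p v) v"
    and "\<And>u v W. walk_betw G u W v \<Longrightarrow> r u = r v"
proof -
  define r where "r v = (SOME w. \<exists>W. walk_betw G w W v)" for v
  have "\<exists>W. walk_betw G (r v) W v" if "v \<in> verts G" for v
    unfolding r_def by (rule someI[of _ v]) (use walk_betw_trivial[OF that] in blast)
  then obtain p where "\<And>v. v \<in> verts G \<Longrightarrow> walk_betw G (r v) (p v) v" by metis
  moreover have "r u = r v" if "walk_betw G u W v" for u v W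
  proof -
    \<comment> \<open>The choices defining \<open>r u\<close> and \<open>r v\<close> are made from
      equivalent predicates, so they pick the same root.\<close>
    have "(\<exists>V. walk_betw G w V u) \<longleftrightarrow> (\<exists>V. walk_betw G w V v)" for w
      using that walk_betw_append walk_betw_rev by metis
    then show ?thesis by (simp add: r_def)
  qed
  ultimately show thesis by (rule that)
qed

text \<open>Rotation is symmetric in the two parts, so closure under it gives an equivalence of
  memberships.\<close>

lemma set_sign_rotation:
  assumes "closed_under_rotation G \<W>" "walk_betw G x P y" "walk_betw G y Q x"
  shows "set_sign \<W> (walk_append P Q) = set_sign \<W> (walk_append Q P)"
proof -
  have "is_rotation G (walk_append P Q) (walk_append Q P)"
    "is_rotation G (walk_append Q P) (walk_append P Q)"
    using assms unfolding is_rotation_def by blast+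
  with assms(1) have "walk_append P Q \<in> \<W> \<longleftrightarrow> walk_append Q P \<in> \<W>"
    unfolding closed_under_rotation_def by blast
  then show ?thesis by (simp add: set_sign_def)
qed

text \<open>Three equal walks give a sign whose cube is 1, which excludes -1.\<close>

lemma set_sign_self:
  assumes "exclusive_3_walk_property G \<W>" and "walk_betw G x A y"
  shows "set_sign \<W> (walk_append A (walk_rev A)) = 1"
proof -
  let ?a = "set_sign \<W> (walk_append A (walk_rev A))"
  have "?a * ?a * ?a = 1"
    using assms walk_betwD(4,5)[OF assms(2)] unfolding exclusive_3_walk_property_def by blast
  then show ?thesis by (simp add: set_sign_def split: if_splits)
qed

lemma set_sign_cocycle:
  assumes "exclusive_3_walk_property G \<W>"
    and "walk_betw G x A y" "walk_betw G x B y" "walk_betw G x C y"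
  shows "set_sign \<W> (walk_append A (walk_rev C)) =
    set_sign \<W> (walk_append A (walk_rev B)) * set_sign \<W> (walk_append B (walk_rev C))"
proof -
  have "set_sign \<W> (walk_append A (walk_rev B)) * set_sign \<W> (walk_append A (walk_rev C)) *
      set_sign \<W> (walk_append B (walk_rev C)) = 1"
    using assms walk_betwD(4,5)[OF assms(2)] unfolding exclusive_3_walk_property_def by blast
  then show ?thesis by (simp add: set_sign_def split: if_splits)
qed

text \<open>In the cocycle rule with both outer walks equal to \<open>A\<close>, the two factors
  multiply to 1, and signs with product 1 are equal.\<close>

lemma set_sign_swap:
  assumes "exclusive_3_walk_property G \<W>" and "walk_betw G x A y" "walk_betw G x B y"
  shows "set_sign \<W> (walk_append A (walk_rev B)) = set_sign \<W> (walk_append B (walk_rev A))"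
  using set_sign_cocycle[OF assms(1-3,2)] set_sign_self[OF assms(1,2)]
  by (simp add: set_sign_def split: if_splits)

lemma set_sign_conjugate:
  assumes rot: "closed_under_rotation G \<W>" and ex: "exclusive_3_walk_property G \<W>"
    and V: "walk_betw G x V x" and p: "walk_betw G r p x"
  shows "set_sign \<W> (walk_append (walk_append p V) (walk_rev p)) = set_sign \<W> V"
proof -
  let ?T = "([x], []) :: ('a, 'b) walk" and ?q = "walk_append (walk_rev p) p"
  note p' = walk_betw_rev[OF p]
  have T: "walk_betw G x ?T x" using walk_betwD(4)[OF V] by (rule walk_betw_trivial)
  have q: "walk_betw G x ?q x" using p' p by (rule walk_betw_append)
  have rev_q: "walk_rev ?q = ?q" using walk_rev_append[OF p' p] by simp
  have rev_T: "walk_rev ?T = ?T" by (simp add: walk_rev_def)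
  have sq: "set_sign \<W> ?q = 1" using set_sign_self[OF ex p'] by simp
  have "set_sign \<W> (walk_append (walk_append p V) (walk_rev p)) =
      set_sign \<W> (walk_append p (walk_append V (walk_rev p)))"
    using walk_betwD(1)[OF V] by (simp add: walk_append_assoc)
  also have "\<dots> = set_sign \<W> (walk_append (walk_append V (walk_rev p)) p)"
    by (rule set_sign_rotation[OF rot p walk_betw_append[OF V p']])
  also have "\<dots> = set_sign \<W> (walk_append V (walk_rev ?q))"
    using walk_betwD(1)[OF p'] by (simp add: walk_append_assoc rev_q)
  \<comment> \<open>The trivial walk is inserted as the middle walk: the factors reduce to the signs
    of \<open>V\<close> and of \<open>?q\<close>, and the latter is 1.\<close>
  also have "\<dots> = set_sign \<W> (walk_append V (walk_rev ?T)) * set_sign \<W> (walk_append ?T (walk_rev ?q))"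
    by (rule set_sign_cocycle[OF ex V T q])
  also have "\<dots> = set_sign \<W> V"
    by (simp add: rev_q rev_T sq walk_append_trivial_left[OF q])
  finally show ?thesis .
qed

lemma signature_from_walks:
  assumes rot: "closed_under_rotation G \<W>" and ex: "exclusive_3_walk_property G \<W>"
    and graph: "is_graph G" and sub: "\<W> \<subseteq> closed_walks G"
  shows "\<exists>\<sigma>\<in>signatures G. \<W> = negative_closed_walks G \<sigma>"
proof -
  obtain r p where p: "\<And>v. v \<in> verts G \<Longrightarrow> walk_betw G (r v) (p v) v"
    and r: "\<And>u v W. walk_betw G u W v \<Longrightarrow> r u = r v"
    using connecting_walks[of G] by metis
  \<comment> \<open>For a walk \<open>V\<close> from \<open>x\<close> to \<open>y\<close> the roots
    \<open>r x\<close> and \<open>r y\<close> agree, so this is the sign of a closed walk.\<close>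
  define s where "s x V y = set_sign \<W> (walk_append (walk_append (p x) V) (walk_rev (p y)))"
    for x V y
  have pV: "walk_betw G (r y) (walk_append (p x) V) y" if "walk_betw G x V y" for x V y
    using walk_betw_append[OF p that] walk_betwD(4)[OF that] r[OF that] by simp
  have s_rev: "s y (walk_rev V) x = s x V y" if V: "walk_betw G x V y" for x V y
  proof -
    note x = p[OF walk_betwD(4)[OF V]] and y = p[OF walk_betwD(5)[OF V]] and V' = walk_betw_rev[OF V]
    have "s x V y = set_sign \<W> (walk_append (p y) (walk_rev (walk_append (p x) V)))"
      unfolding s_def by (rule set_sign_swap[OF ex pV[OF V] y])
    also have "\<dots> = s y (walk_rev V) x"
      using walk_rev_append[OF x V] walk_betwD(1)[OF V'] by (simp add: s_def walk_append_assoc)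
    finally show ?thesis ..
  qed
  have s_append: "s x (walk_append U V) z = s x U y * s y V z"
    if U: "walk_betw G x U y" and V: "walk_betw G y V z" for x U y V z
  proof -
    \<comment> \<open>This walk reaches \<open>y\<close> from the root by way of \<open>z\<close>,
      so it can be compared with \<open>p x\<close> followed by \<open>U\<close> and with
      \<open>p y\<close> in the cocycle rule.\<close>
    let ?C = "walk_append (p z) (walk_rev V)"
    note y = p[OF walk_betwD(4)[OF V]] and z = p[OF walk_betwD(5)[OF V]] and V' = walk_betw_rev[OF V]
    have rev_C: "walk_rev ?C = walk_append V (walk_rev (p z))"
      using walk_rev_append[OF z V'] by simp
    have "s x (walk_append U V) z = set_sign \<W> (walk_append (walk_append (p x) U) (walk_rev ?C))"
      using walk_betwD(1)[OF U] walk_betwD(1)[OF V] walk_betwD(1)[OF walk_betw_append[OF U V]]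
      by (simp add: s_def rev_C walk_append_assoc)
    also have "\<dots> = s x U y * set_sign \<W> (walk_append (p y) (walk_rev ?C))"
      unfolding s_def by (rule set_sign_cocycle[OF ex pV[OF U] y pV[OF V']])
    also have "set_sign \<W> (walk_append (p y) (walk_rev ?C)) = s y V z"
      using walk_betwD(1)[OF V] by (simp add: s_def rev_C walk_append_assoc)
    finally show ?thesis .
  qed
  \<comment> \<open>An unordered pair can be read in two orders; \<open>s_rev\<close> shows that
    both give the same sign.\<close>
  have edge_sign: "\<exists>t. t \<in> {1, - 1} \<and> (\<forall>x y. ends G e = Upair x y \<longrightarrow> s x ([x, y], [e]) y = t)"
    if e: "e \<in> edges G" for e
  proof -
    obtain u v where uv: "ends G e = Upair u v" by (cases "ends G e")
    with graph e have "u \<in> verts G" "v \<in> verts G" by (auto simp: is_graph_def)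
    then have "walk_betw G u ([u, v], [e]) v" using e uv by (intro walk_betw_edge)
    from s_rev[OF this] have swap: "s v ([v, u], [e]) u = s u ([u, v], [e]) v"
      by (simp add: walk_rev_def)
    show ?thesis
      by (rule exI[of _ "s u ([u, v], [e]) v"])
        (use uv swap in \<open>auto simp: s_def set_sign_range[simplified]\<close>)
  qed
  define t where "t e = (SOME t. t \<in> {1, - 1} \<and> (\<forall>x y. ends G e = Upair x y \<longrightarrow> s x ([x, y], [e]) y = t))"
    for e
  have t: "t e \<in> {1, - 1} \<and> (\<forall>x y. ends G e = Upair x y \<longrightarrow> s x ([x, y], [e]) y = t e)"
    if "e \<in> edges G" for e
    unfolding t_def by (rule someI_ex[OF edge_sign[OF that]])
  \<comment> \<open>Members of \<open>signatures G\<close> are extensional, hence the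
    restriction.\<close>
  define \<sigma> where "\<sigma> = restrict t (edges G)"
  have "\<sigma> \<in> signatures G" using t by (auto simp: signatures_def \<sigma>_def)
  have s_walk: "s x (vs, es) y = (- 1) ^ length (filter (\<lambda>e. \<sigma> e = - 1) es)"
    if "walk_betw G x (vs, es) y" for x vs es y
    using that
  proof (induction rule: walk_betw_induct)
    case (trivial x)
    then show ?case using set_sign_self[OF ex p[OF trivial]] by (simp add: s_def)
  next
    case (step x v vs e es y)
    have "walk_betw G x ([x, v], [e]) v"
      using step walk_betwD(4) by (metis walk_betw_edge)
    moreover have "walk_append ([x, v], [e]) (vs, es) = (x # vs, e # es)"
      using step.hyps by (cases vs) (auto simp: walk_append_def)
    ultimately have "s x (x # vs, e # es) y = s x ([x, v], [e]) v * s v (vs, es) y"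
      using s_append step.hyps by metis
    then show ?case using t[of e] step by (auto simp: \<sigma>_def)
  qed
  have "W \<in> \<W> \<longleftrightarrow> W \<in> negative_closed_walks G \<sigma>" if W: "W \<in> closed_walks G" for W
  proof -
    from W obtain x where x: "walk_betw G x W x" by (auto simp: closed_walks_def)
    have "set_sign \<W> W = s x W x"
      unfolding s_def by (rule set_sign_conjugate[OF rot ex x p[OF walk_betwD(4)[OF x]], symmetric])
    also have "\<dots> = (- 1) ^ length (filter (\<lambda>e. \<sigma> e = - 1) (snd W))"
      using s_walk[of x "fst W" "snd W" x] x by simp
    finally show ?thesis
      using W by (auto simp: set_sign_def negative_closed_walks_def minus_one_power_iff split: if_splits)
  qed
  \<comment> \<open>Both sets consist of closed walks, so agreement on those suffices.\<close>
  with sub have "\<W> = negative_closed_walks G \<sigma>" by (auto simp: negative_closed_walks_def)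
  with \<open>\<sigma> \<in> signatures G\<close> show ?thesis by blast
qed

theorem theorem3:
  fixes G :: "('v, 'e) mgraph" and \<W> :: "('v, 'e) walk set"
  assumes "is_graph G"
    and "\<W> \<subseteq> closed_walks G"
  shows "(\<exists>\<sigma>\<in>signatures G. \<W> = negative_closed_walks G \<sigma>) \<longleftrightarrow>
    closed_under_rotation G \<W> \<and> exclusive_3_walk_property G \<W>"
  using assms signature_from_walks negative_closed_walks_rotation negative_closed_walks_exclusive
  by blast

end
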